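(* Let $\mu_{\rm A}^*$ be the Ramsey two-part tariff policy and $p_{\mu_{\rm A}^*}$ its market potential function. For any initial state $\sigma_0=(T_0,R_0)$ with $0\le R_0\le p_{\mu_{\rm A}^*}(0)$, the policy $\mu_{\rm A}^*$ induces an adoption (trajectory $(\sigma_k)_{k\ge0}$) approaching the unique stable equilibrium $\big(\mu_{\rm A}^*(p_{\mu_{\rm A}^*}(0)),\,p_{\mu_{\rm A}^*}(0)\big)$.
   Context: Tariffs and surplus. There are $M$ consumers and $N$ consumption periods. A two-part tariff $T=(A,\pi)$ with connection charge $A$ and volumetric price $\pi\in\mathbb{R}^N$ charges $T(d)=A+\pi^\top d$ for net consumption $d\in\mathbb{R}^N$; the class of such tariffs is $\mathscr{T}_{\rm A}$. $\omega=(\omega_1,\ldots,\omega_M)$ is an exogenous random state, $\lambda\in\mathbb{R}^N$ the (random) wholesale price, $r_0(\omega)\in\mathbb{R}^N$ the renewable generation per unit of installed capacity, $R\ge0$ the installed capacity, $\theta$ the operating cost of the retailer. Facing $T$, consumer $i$ with own renewable generation $r_i(\omega_i)$ chooses its (state-dependent) consumption $D_i(T,\omega_i)$ to maximize $\mathbb{E}[u_i(q,\omega_i)-T(q-r_i(\omega_i))]$, where $u_i$ is its utility; demand is price-elastic. $D=\sum_iD_i$ is the aggregate demand (it depends on $T$ only through $\pi$, written $D(\pi,\omega)$), and $U(T,\omega)=\sum_iu_i(D_i(T,\omega_i),\omega_i)$. Define $\overline{\rm cs}(T,R)=\mathbb{E}[U(T,\omega)-\pi^\top(D(\pi,\omega)-Rr_0(\omega))]-MA$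 and $\overline{\rm rs}(T,\theta,R)=\mathbb{E}[(\pi-\lambda)^\top(D(\pi,\omega)-Rr_0(\omega))]+MA-\theta$. The Ramsey two-part tariff policy $\mu_{\rm A}^*$ maps $(R,\theta)$ to a maximizer of $\overline{\rm cs}(T,R)$ over $T\in\mathscr{T}_{\rm A}$ subject to $\overline{\rm rs}(T,\theta,R)=0$. Dynamics. $\theta$ and the per-unit solar cost $\xi$ are fixed and suppressed. $R_\infty(T)=R_\infty(T,\xi)$ is the market potential under tariff $T$; it depends on $T$ only through the volumetric price $\pi$ (adoption is determined by the payback time $\xi/\mathbb{E}[\pi^\top r_0(\omega)]$ of a solar investment). $\eta:[0,\infty)\to[0,1)$ is a sigmoid function (continuous, strictly increasing, $\eta(0)=0$, $\lim_{t\to\infty}\eta(t)=1$); $s(t,T)=R_\infty(T)\eta(t)$. States $\sigma_k=(T_k,R_k)$ evolve under a policy $\mu$ by $\sigma_{k+1}=f(\sigma_k)$, where $T_{k+1}=\mu(R_k)$ and $R_{k+1}=R_k$ if $R_\infty(T_{k+1})<R_k$, and $R_{k+1}=s\big(1+\eta^{-1}(R_k/R_\infty(T_{k+1})),T_{k+1}\big)$ otherwise (read as $R_{k+1}=R_k$ when $R_\infty(T_{k+1})=R_k$). The evolution is a death spiral if it reaches a state at whose capacity no tariff in the class with $\overline{\rm rs}=0$ exists. The market potential function is $p_\mu(R)=R_\infty(\mu(R))$. Stability. A state $\sigma^*$ is an equilibrium if $\sigma^*=f(\sigma^* )$; it is (Lyapunov) stable if for each $\epsilon>0$ there is $\delta$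 such that, for every trajectory that is not a death spiral, $\|\sigma_0-\sigma^*\|<\delta$ implies $\|\sigma_k-\sigma^*\|<\epsilon$ for all $k>0$.
   Formalization: Uniqueness of the stable equilibrium is claimed only among states with 0 ≤ R ≤ p(0), since every (μ(R),R) with R > p(0) is also a stable equilibrium; if the optimal volumetric price is not unique, the Ramsey policy is assumed to choose it by a rule depending only on the set of optimal prices. *)

theory Defs
  imports "HOL-Probability.Probability"
begin

text \<open>
  Consumers are indexed by the finite type \<open>'m\<close> and consumption periods by the finite type
  \<open>'n\<close>, so that M is \<open>CARD('m)\<close> and N is \<open>CARD('n)\<close>. The pair \<open>(A, \<pi>)\<close> is the two-part
  tariff with connection charge \<open>A\<close> and volumetric price \<open>\<pi>\<close>.
\<close>

type_synonym 'n tariff = "real \<times> (real ^ 'n)"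

definition payment :: "('n::finite) tariff \<Rightarrow> real ^ 'n \<Rightarrow> real" where
  "payment T d = fst T + snd T \<bullet> d"

text \<open>
  All randomness lives on \<open>sample\<close>; \<open>omega i\<close> is the random state of consumer \<open>i\<close>, with values in
  \<open>local_states i\<close>. The wholesale price is a random variable of its own: it may be correlated
  with the consumers' states but need not be a function of them.
\<close>

record ('x, 'w, 'm, 'n::finite) market =
  sample :: "'x measure"
  local_states :: "'m \<Rightarrow> 'w measure"
  omega :: "'m \<Rightarrow> 'x \<Rightarrow> 'w"
  utility :: "'m \<Rightarrow> real ^ 'n \<Rightarrow> 'w \<Rightarrow> real"
  own_renewable :: "'m \<Rightarrow> 'w \<Rightarrow> real ^ 'n"
  demand :: "'m \<Rightarrow> 'n tariff \<Rightarrow> 'w \<Rightarrow> real ^ 'n"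
  wholesale :: "'x \<Rightarrow> real ^ 'n"
  unit_renewable :: "('m \<Rightarrow> 'w) \<Rightarrow> real ^ 'n"

definition joint_state :: "('x, 'w, 'm, 'n::finite) market \<Rightarrow> 'x \<Rightarrow> 'm \<Rightarrow> 'w" where
  "joint_state m x = (\<lambda>i. omega m i x)"

definition aggregate_demand ::
  "('x, 'w, 'm::finite, 'n::finite) market \<Rightarrow> 'n tariff \<Rightarrow> ('m \<Rightarrow> 'w) \<Rightarrow> real ^ 'n" where
  "aggregate_demand m T w = (\<Sum>i\<in>UNIV. demand m i T (w i))"

definition aggregate_utility ::
  "('x, 'w, 'm::finite, 'n::finite) market \<Rightarrow> 'n tariff \<Rightarrow> ('m \<Rightarrow> 'w) \<Rightarrow> real" where
  "aggregate_utility m T w = (\<Sum>i\<in>UNIV. utility m i (demand m i T (w i)) (w i))"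

definition net_benefit ::
  "('x, 'w, 'm, 'n::finite) market \<Rightarrow> 'm \<Rightarrow> 'n tariff \<Rightarrow> ('w \<Rightarrow> real ^ 'n) \<Rightarrow> 'x \<Rightarrow> real" where
  "net_benefit m i T q x =
     (let w = omega m i x
      in utility m i (q w) w - payment T (q w - own_renewable m i w))"

text \<open>
  A consumption plan is a function of the consumer's own state. The maximum is over all measurable
  plans whose expected net benefit is finite.
\<close>

definition admissible_plan ::
  "('x, 'w, 'm, 'n::finite) market \<Rightarrow> 'm \<Rightarrow> 'n tariff \<Rightarrow> ('w \<Rightarrow> real ^ 'n) \<Rightarrow> bool" where
  "admissible_plan m i T q \<longleftrightarrow>
     q \<in> borel_measurable (local_states m i) \<and> integrable (sample m) (net_benefit m i T q)"

definition optimal_plan ::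
  "('x, 'w, 'm, 'n::finite) market \<Rightarrow> 'm \<Rightarrow> 'n tariff \<Rightarrow> ('w \<Rightarrow> real ^ 'n) \<Rightarrow> bool" where
  "optimal_plan m i T d \<longleftrightarrow>
     admissible_plan m i T d \<and>
     (\<forall>q. admissible_plan m i T q \<longrightarrow>
        integral\<^sup>L (sample m) (net_benefit m i T q)
          \<le> integral\<^sup>L (sample m) (net_benefit m i T d))"

text \<open>
  The integrability conditions make the expectations in the definitions of consumer and retailer
  surplus genuine (the Bochner integral of a non-integrable function is 0).
\<close>

definition well_posed :: "('x, 'w, 'm::finite, 'n::finite) market \<Rightarrow> bool" where
  "well_posed m \<longleftrightarrow>
     prob_space (sample m) \<and>
     (\<forall>i. omega m i \<in> sample m \<rightarrow>\<^sub>M local_states m i) \<and>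
     (\<forall>i. own_renewable m i \<in> borel_measurable (local_states m i)) \<and>
     (\<forall>i. integrable (sample m) (\<lambda>x. own_renewable m i (omega m i x))) \<and>
     wholesale m \<in> borel_measurable (sample m) \<and>
     integrable (sample m) (\<lambda>x. unit_renewable m (joint_state m x)) \<and>
     integrable (sample m) (\<lambda>x. wholesale m x \<bullet> unit_renewable m (joint_state m x)) \<and>
     (\<forall>i T. optimal_plan m i T (demand m i T)) \<and>
     (\<forall>i A A' \<pi>. demand m i (A, \<pi>) = demand m i (A', \<pi>)) \<and>
     (\<forall>i T. integrable (sample m) (\<lambda>x. demand m i T (omega m i x))) \<and>
     (\<forall>i T. integrable (sample m) (\<lambda>x. utility m i (demand m i T (omega m i x)) (omega m i x))) \<and>
     (\<forall>i T. integrable (sample m) (\<lambda>x. wholesale m x \<bullet> demand m i T (omega m i x)))"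

definition consumer_surplus ::
  "('x, 'w, 'm::finite, 'n::finite) market \<Rightarrow> 'n tariff \<Rightarrow> real \<Rightarrow> real" where
  "consumer_surplus m T R =
     (\<integral>x. aggregate_utility m T (joint_state m x)
           - snd T \<bullet> (aggregate_demand m T (joint_state m x)
                      - R *\<^sub>R unit_renewable m (joint_state m x)) \<partial>sample m)
     - real CARD('m) * fst T"

definition retailer_surplus ::
  "('x, 'w, 'm::finite, 'n::finite) market \<Rightarrow> 'n tariff \<Rightarrow> real \<Rightarrow> real \<Rightarrow> real" where
  "retailer_surplus m T \<theta> R =
     (\<integral>x. (snd T - wholesale m x) \<bullet> (aggregate_demand m T (joint_state m x)
                      - R *\<^sub>R unit_renewable m (joint_state m x)) \<partial>sample m)
     + real CARD('m) * fst T - \<theta>"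

definition ramsey_tariff ::
  "('x, 'w, 'm::finite, 'n::finite) market \<Rightarrow> real \<Rightarrow> real \<Rightarrow> 'n tariff \<Rightarrow> bool" where
  "ramsey_tariff m \<theta> R T \<longleftrightarrow>
     retailer_surplus m T \<theta> R = 0 \<and>
     (\<forall>T'. retailer_surplus m T' \<theta> R = 0 \<longrightarrow> consumer_surplus m T' R \<le> consumer_surplus m T R)"

definition ramsey_prices ::
  "('x, 'w, 'm::finite, 'n::finite) market \<Rightarrow> real \<Rightarrow> real \<Rightarrow> (real ^ 'n) set" where
  "ramsey_prices m \<theta> R = snd ` {T. ramsey_tariff m \<theta> R T}"

text \<open>
  The maximizer need not be unique. The second conjunct says that ties are broken consistently:
  the volumetric price is selected from the set of optimal volumetric prices by a rule that
  depends on that set only. It holds automatically if the optimal volumetric price is unique.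
\<close>

definition ramsey_policy ::
  "('x, 'w, 'm::finite, 'n::finite) market \<Rightarrow> real \<Rightarrow> (real \<Rightarrow> 'n tariff) \<Rightarrow> bool" where
  "ramsey_policy m \<theta> \<mu> \<longleftrightarrow>
     (\<forall>R\<ge>0. (\<exists>T. retailer_surplus m T \<theta> R = 0) \<longrightarrow> ramsey_tariff m \<theta> R (\<mu> R)) \<and>
     (\<forall>R\<ge>0. \<forall>R'\<ge>0. ramsey_prices m \<theta> R = ramsey_prices m \<theta> R' \<longrightarrow> snd (\<mu> R) = snd (\<mu> R'))"

definition sigmoid :: "(real \<Rightarrow> real) \<Rightarrow> bool" where
  "sigmoid \<eta> \<longleftrightarrow>
     \<eta> ` {0..} \<subseteq> {0..<1} \<and> continuous_on {0..} \<eta> \<and> strict_mono_on {0..} \<eta> \<and>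
     \<eta> 0 = 0 \<and> (\<eta> \<longlongrightarrow> 1) at_top"

definition price_driven_potential :: "(('n::finite) tariff \<Rightarrow> real) \<Rightarrow> bool" where
  "price_driven_potential Rinf \<longleftrightarrow>
     (\<forall>T. 0 \<le> Rinf T) \<and> (\<forall>A A' \<pi>. Rinf (A, \<pi>) = Rinf (A', \<pi>))"

definition adoption_curve :: "(real \<Rightarrow> real) \<Rightarrow> (('n::finite) tariff \<Rightarrow> real) \<Rightarrow> real \<Rightarrow> 'n tariff \<Rightarrow> real" where
  "adoption_curve \<eta> Rinf t T = Rinf T * \<eta> t"

definition potential_of_policy ::
  "(('n::finite) tariff \<Rightarrow> real) \<Rightarrow> (real \<Rightarrow> 'n tariff) \<Rightarrow> real \<Rightarrow> real" where
  "potential_of_policy Rinf \<mu> R = Rinf (\<mu> R)"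

type_synonym 'n state = "'n tariff \<times> real"

text \<open>
  In the last branch \<open>R / Rinf T'\<close> lies in \<open>{0..<1} = \<eta> ` {0..}\<close> for every sigmoid \<open>\<eta>\<close> and
  \<open>R \<ge> 0\<close>, so \<open>inv_into {0..} \<eta>\<close> is the inverse of \<open>\<eta>\<close> there.
\<close>

definition evolve ::
  "(real \<Rightarrow> real) \<Rightarrow> (('n::finite) tariff \<Rightarrow> real) \<Rightarrow> (real \<Rightarrow> 'n tariff) \<Rightarrow> 'n state \<Rightarrow> 'n state" where
  "evolve \<eta> Rinf \<mu> \<sigma> =
     (let R = snd \<sigma>; T' = \<mu> R
      in (T', if Rinf T' \<le> R then R
              else adoption_curve \<eta> Rinf (1 + inv_into {0..} \<eta> (R / Rinf T')) T'))"

definition trajectory ::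
  "(real \<Rightarrow> real) \<Rightarrow> (('n::finite) tariff \<Rightarrow> real) \<Rightarrow> (real \<Rightarrow> 'n tariff) \<Rightarrow> 'n state \<Rightarrow> nat \<Rightarrow> 'n state" where
  "trajectory \<eta> Rinf \<mu> \<sigma>\<^sub>0 k = (evolve \<eta> Rinf \<mu> ^^ k) \<sigma>\<^sub>0"

definition death_spiral ::
  "('x, 'w, 'm::finite, 'n::finite) market \<Rightarrow> real \<Rightarrow> (nat \<Rightarrow> 'n state) \<Rightarrow> bool" where
  "death_spiral m \<theta> \<sigma> \<longleftrightarrow> (\<exists>k. \<not> (\<exists>T. retailer_surplus m T \<theta> (snd (\<sigma> k)) = 0))"

text \<open>The state space consists of the pairs \<open>(T, R)\<close> with \<open>0 \<le> R\<close>.\<close>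

definition equilibrium ::
  "(real \<Rightarrow> real) \<Rightarrow> (('n::finite) tariff \<Rightarrow> real) \<Rightarrow> (real \<Rightarrow> 'n tariff) \<Rightarrow> 'n state \<Rightarrow> bool" where
  "equilibrium \<eta> Rinf \<mu> \<sigma> \<longleftrightarrow> 0 \<le> snd \<sigma> \<and> \<sigma> = evolve \<eta> Rinf \<mu> \<sigma>"

definition lyapunov_stable ::
  "('x, 'w, 'm::finite, 'n::finite) market \<Rightarrow> real \<Rightarrow> (real \<Rightarrow> real) \<Rightarrow> ('n tariff \<Rightarrow> real) \<Rightarrow>
   (real \<Rightarrow> 'n tariff) \<Rightarrow> 'n state \<Rightarrow> bool" where
  "lyapunov_stable m \<theta> \<eta> Rinf \<mu> \<sigma>\<^sub>s \<longleftrightarrow>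
     (\<forall>\<epsilon>>0. \<exists>\<delta>>0. \<forall>\<sigma>\<^sub>0. 0 \<le> snd \<sigma>\<^sub>0 \<and> \<not> death_spiral m \<theta> (trajectory \<eta> Rinf \<mu> \<sigma>\<^sub>0) \<and>
        norm (\<sigma>\<^sub>0 - \<sigma>\<^sub>s) < \<delta> \<longrightarrow>
        (\<forall>k>0. norm (trajectory \<eta> Rinf \<mu> \<sigma>\<^sub>0 k - \<sigma>\<^sub>s) < \<epsilon>))"

definition stable_equilibrium ::
  "('x, 'w, 'm::finite, 'n::finite) market \<Rightarrow> real \<Rightarrow> (real \<Rightarrow> real) \<Rightarrow> ('n tariff \<Rightarrow> real) \<Rightarrow>
   (real \<Rightarrow> 'n tariff) \<Rightarrow> 'n state \<Rightarrow> bool" where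
  "stable_equilibrium m \<theta> \<eta> Rinf \<mu> \<sigma> \<longleftrightarrow>
     equilibrium \<eta> Rinf \<mu> \<sigma> \<and> lyapunov_stable m \<theta> \<eta> Rinf \<mu> \<sigma>"

end

theory Submission
  imports Defs
begin

text \<open>
  On the break-even set the connection charge cancels: there the consumer surplus equals the expected
  gross utility minus the wholesale cost of the demand, plus a term that is affine in \<open>R\<close> and does
  not involve the tariff. So the set of optimal volumetric prices does not depend on \<open>R\<close>, the policy
  keeps its volumetric price, and the market potential along every trajectory is the constant
  \<open>p 0\<close>, while the connection charge is affine in \<open>R\<close>. A capacity below \<open>p 0\<close> climbs the fixed curve
  \<open>t \<mapsto> p 0 * \<eta> t\<close> in unit steps; a capacity above it does not move.
\<close>

section \<open>Surplus\<close>

lemma aggregate_demand_connection_charge: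
  assumes "well_posed m"
  shows "aggregate_demand m (A, \<pi>) = aggregate_demand m (A', \<pi>)"
proof -
  have "demand m i (A, \<pi>) = demand m i (A', \<pi>)" for i
    using assms unfolding well_posed_def by blast
  then show ?thesis
    by (simp add: aggregate_demand_def fun_eq_iff)
qed

lemma aggregate_utility_connection_charge:
  assumes "well_posed m"
  shows "aggregate_utility m (A, \<pi>) = aggregate_utility m (A', \<pi>)"
proof -
  have "demand m i (A, \<pi>) = demand m i (A', \<pi>)" for i
    using assms unfolding well_posed_def by blast
  then show ?thesis
    by (simp add: aggregate_utility_def fun_eq_iff)
qed

text \<open>Splitting the expectations in the surplus formulas is legitimate only for integrable
  summands; the conditions on single consumers add up over the finite type
  \<open>'m\<close>.\<close>

lemma well_posed_integrable:
  assumes "well_posed m"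
  shows "integrable (sample m) (\<lambda>x. aggregate_demand m T (joint_state m x))"
    and "integrable (sample m) (\<lambda>x. aggregate_utility m T (joint_state m x))"
    and "integrable (sample m) (\<lambda>x. wholesale m x \<bullet> aggregate_demand m T (joint_state m x))"
    and "integrable (sample m) (\<lambda>x. unit_renewable m (joint_state m x))"
    and "integrable (sample m) (\<lambda>x. wholesale m x \<bullet> unit_renewable m (joint_state m x))"
  using assms
  unfolding well_posed_def aggregate_demand_def aggregate_utility_def joint_state_def inner_sum_right
  by (auto intro!: Bochner_Integration.integrable_sum simp del: split_paired_All)

text \<open>The charge \<open>0\<close> is an arbitrary representative: demand is blind to the
  connection charge, so this and \<open>price_welfare\<close> depend on the price alone.\<close>

definition demand_margin :: "('x, 'w, 'm::finite, 'n::finite) market \<Rightarrow> real ^ 'n \<Rightarrow> real" where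
  "demand_margin m \<pi> =
     (\<integral>x. (\<pi> - wholesale m x) \<bullet> aggregate_demand m (0, \<pi>) (joint_state m x) \<partial>sample m)"

definition renewable_margin :: "('x, 'w, 'm::finite, 'n::finite) market \<Rightarrow> real ^ 'n \<Rightarrow> real" where
  "renewable_margin m \<pi> =
     (\<integral>x. (\<pi> - wholesale m x) \<bullet> unit_renewable m (joint_state m x) \<partial>sample m)"

definition price_welfare :: "('x, 'w, 'm::finite, 'n::finite) market \<Rightarrow> real ^ 'n \<Rightarrow> real" where
  "price_welfare m \<pi> =
     (\<integral>x. aggregate_utility m (0, \<pi>) (joint_state m x)
           - wholesale m x \<bullet> aggregate_demand m (0, \<pi>) (joint_state m x) \<partial>sample m)"

text \<open>Being affine in \<open>A\<close> with nonzero slope yields a break-even charge for every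
  price; being affine in \<open>R\<close> makes that charge affine in \<open>R\<close>.\<close>

lemma retailer_surplus_eq:
  fixes m :: "('x, 'w, 'm::finite, 'n::finite) market"
  assumes "well_posed m"
  shows "retailer_surplus m (A, \<pi>) \<theta> R =
           demand_margin m \<pi> - R * renewable_margin m \<pi> + real CARD('m) * A - \<theta>"
proof -
  note int = well_posed_integrable[OF assms]
  have 1: "integrable (sample m)
      (\<lambda>x. (\<pi> - wholesale m x) \<bullet> aggregate_demand m (0, \<pi>) (joint_state m x))"
    and 2: "integrable (sample m) (\<lambda>x. (\<pi> - wholesale m x) \<bullet> unit_renewable m (joint_state m x))"
    using int by (simp_all add: inner_diff_left)
  show ?thesis
    unfolding retailer_surplus_def demand_margin_def renewable_margin_def
      aggregate_demand_connection_charge[OF assms, of A \<pi> 0]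
    using 1 2 by (simp add: inner_diff_right)
qed

text \<open>Payments, volumetric and fixed, are transfers from consumers to retailer and cancel in
  the sum. What \<open>R\<close> contributes is the wholesale value of the renewables, the same for
  all tariffs.\<close>

lemma total_surplus_eq:
  assumes "well_posed m"
  shows "consumer_surplus m (A, \<pi>) R + retailer_surplus m (A, \<pi>) \<theta> R =
           price_welfare m \<pi>
           + R * (\<integral>x. wholesale m x \<bullet> unit_renewable m (joint_state m x) \<partial>sample m) - \<theta>"
proof -
  note int = well_posed_integrable[OF assms]
  show ?thesis
    unfolding consumer_surplus_def retailer_surplus_def price_welfare_def
      aggregate_demand_connection_charge[OF assms, of A \<pi> 0]
      aggregate_utility_connection_charge[OF assms, of A \<pi> 0]
    using int by (simp add: inner_diff_right inner_diff_left algebra_simps)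
qed

section \<open>Break-even tariffs, Ramsey prices and the policy\<close>

lemma break_even_charge_exists:
  fixes m :: "('x, 'w, 'm::finite, 'n::finite) market"
  assumes "well_posed m"
  shows "\<exists>A. retailer_surplus m (A, \<pi>) \<theta> R = 0"
proof
  \<comment> \<open>The witness solves the affine equation of \<open>retailer_surplus_eq\<close> for
    \<open>A\<close>. A charge may have either sign, so it absorbs any deficit or profit.\<close>
  show "retailer_surplus m
      ((\<theta> - demand_margin m \<pi> + R * renewable_margin m \<pi>) / real CARD('m), \<pi>) \<theta> R = 0"
    by (simp add: retailer_surplus_eq[OF assms])
qed

text \<open>Where the retailer breaks even, consumer surplus is total surplus, so two tariffs
  compare exactly as their values of \<open>price_welfare\<close>.\<close>

lemma ramsey_tariff_iff:
  assumes "well_posed m"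
  shows "ramsey_tariff m \<theta> R (A, \<pi>) \<longleftrightarrow>
           retailer_surplus m (A, \<pi>) \<theta> R = 0 \<and> (\<forall>\<pi>'. price_welfare m \<pi>' \<le> price_welfare m \<pi>)"
proof -
  have cs: "consumer_surplus m (B, \<rho>) R = price_welfare m \<rho>
           + R * (\<integral>x. wholesale m x \<bullet> unit_renewable m (joint_state m x) \<partial>sample m) - \<theta>"
    if "retailer_surplus m (B, \<rho>) \<theta> R = 0" for B \<rho>
    using total_surplus_eq[OF assms, of B \<rho> R \<theta>] that by simp
  show ?thesis
  proof
    assume ram: "ramsey_tariff m \<theta> R (A, \<pi>)"
    then have be: "retailer_surplus m (A, \<pi>) \<theta> R = 0"
      by (simp add: ramsey_tariff_def)
    have "price_welfare m \<pi>' \<le> price_welfare m \<pi>" for \<pi>'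
    proof -
      \<comment> \<open>The rival price enters the Ramsey problem only as part of a feasible tariff,
        so it is completed by its own break-even charge.\<close>
      obtain B where B: "retailer_surplus m (B, \<pi>') \<theta> R = 0"
        using break_even_charge_exists[OF assms] by blast
      then have "consumer_surplus m (B, \<pi>') R \<le> consumer_surplus m (A, \<pi>) R"
        using ram by (simp add: ramsey_tariff_def)
      then show ?thesis
        using cs[OF B] cs[OF be] by simp
    qed
    with be show "retailer_surplus m (A, \<pi>) \<theta> R = 0
        \<and> (\<forall>\<pi>'. price_welfare m \<pi>' \<le> price_welfare m \<pi>)"
      by simp
  next
    assume "retailer_surplus m (A, \<pi>) \<theta> R = 0 \<and> (\<forall>\<pi>'. price_welfare m \<pi>' \<le> price_welfare m \<pi>)"
    then show "ramsey_tariff m \<theta> R (A, \<pi>)"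
      unfolding ramsey_tariff_def by (auto simp: cs)
  qed
qed

lemma ramsey_prices_eq:
  assumes "well_posed m"
  shows "ramsey_prices m \<theta> R = {\<pi>. \<forall>\<pi>'. price_welfare m \<pi>' \<le> price_welfare m \<pi>}"
proof -
  have "ramsey_prices m \<theta> R = {\<pi>. \<exists>A. ramsey_tariff m \<theta> R (A, \<pi>)}"
    unfolding ramsey_prices_def by force
  then show ?thesis
    using break_even_charge_exists[OF assms] by (auto simp: ramsey_tariff_iff[OF assms])
qed

lemma not_death_spiral:
  assumes "well_posed m"
  shows "\<not> death_spiral m \<theta> \<sigma>"
  unfolding death_spiral_def using break_even_charge_exists[OF assms] by blast

text \<open>The sets of optimal prices coincide, and the consistent tie-breaking in
  \<open>ramsey_policy\<close> turns this into equality of the selected prices.\<close>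

lemma ramsey_policy_price:
  assumes "well_posed m" and "ramsey_policy m \<theta> \<mu>" and "0 \<le> R" and "0 \<le> R'"
  shows "snd (\<mu> R) = snd (\<mu> R')"
proof -
  have "ramsey_prices m \<theta> R = ramsey_prices m \<theta> R'"
    by (simp only: ramsey_prices_eq[OF assms(1)])
  with conjunct2[OF assms(2)[unfolded ramsey_policy_def], rule_format, OF assms(3,4)]
  show ?thesis .
qed

text \<open>With the price frozen, breaking even determines the charge as an affine function of
  \<open>R\<close>. The bound later transfers estimates on capacities to tariffs.\<close>

lemma ramsey_policy_lipschitz:
  fixes m :: "('x, 'w, 'm::finite, 'n::finite) market"
  assumes "well_posed m" and "ramsey_policy m \<theta> \<mu>"
  obtains c where "0 \<le> c"
    and "\<And>R R'. 0 \<le> R \<Longrightarrow> 0 \<le> R' \<Longrightarrow> norm (\<mu> R - \<mu> R') \<le> c * \<bar>R - R'\<bar>"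
proof -
  let ?M = "real CARD('m)"
  let ?b = "renewable_margin m (snd (\<mu> 0))"
  have be: "?M * fst (\<mu> R) = R * ?b + \<theta> - demand_margin m (snd (\<mu> 0))" if "0 \<le> R" for R
  proof -
    have "ramsey_tariff m \<theta> R (\<mu> R)"
      using assms(2) that break_even_charge_exists[OF assms(1)] unfolding ramsey_policy_def by blast
    then have "retailer_surplus m (fst (\<mu> R), snd (\<mu> R)) \<theta> R = 0"
      by (simp add: ramsey_tariff_def)
    then show ?thesis
      unfolding retailer_surplus_eq[OF assms(1)] ramsey_policy_price[OF assms that order_refl]
      by simp
  qed
  show ?thesis
  proof
    show "0 \<le> \<bar>?b\<bar> / ?M"
      by simp
    fix R R' :: real
    assume R: "0 \<le> R" "0 \<le> R'"
    have "?M * (fst (\<mu> R) - fst (\<mu> R')) = ?b * (R - R')"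
      using be[OF R(1)] be[OF R(2)] by (simp add: algebra_simps)
    then have "fst (\<mu> R) - fst (\<mu> R') = ?b * (R - R') / ?M"
      by (simp add: field_simps)
    \<comment> \<open>The price components agree, so only the charges contribute to the product
      norm.\<close>
    moreover have "norm (\<mu> R - \<mu> R') = \<bar>fst (\<mu> R) - fst (\<mu> R')\<bar>"
      using ramsey_policy_price[OF assms R] by (simp add: norm_prod_def)
    ultimately show "norm (\<mu> R - \<mu> R') \<le> \<bar>?b\<bar> / ?M * \<bar>R - R'\<bar>"
      by (simp add: abs_mult)
  qed
qed

section \<open>Adoption under a constant market potential\<close>

text \<open>The capacity component of \<open>evolve\<close> for market potential \<open>P\<close>.
  For \<open>0 \<le> R\<close> the first branch catches both \<open>R = P\<close>, where
  \<open>R / P\<close> is not a value of \<eta>, and \<open>P = 0\<close>.\<close>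

definition capacity_step :: "(real \<Rightarrow> real) \<Rightarrow> real \<Rightarrow> real \<Rightarrow> real" where
  "capacity_step \<eta> P R = (if P \<le> R then R else P * \<eta> (1 + inv_into {0..} \<eta> (R / P)))"

lemma sigmoid_less_1:
  assumes "sigmoid \<eta>" and "0 \<le> t"
  shows "\<eta> t < 1"
  using assms by (simp add: sigmoid_def image_subset_iff)

text \<open>Intermediate value theorem between \<open>\<eta> 0 = 0\<close> and a point where the
  limit 1 has pushed \<eta> above \<open>y\<close>. This makes \<open>inv_into\<close> a true
  inverse at \<open>R / P\<close>.\<close>

lemma sigmoid_image:
  assumes "sigmoid \<eta>" and "0 \<le> y" and "y < 1"
  shows "y \<in> \<eta> ` {0..}"
proof -
  have "eventually (\<lambda>t. y < \<eta> t \<and> 0 \<le> t) at_top"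
  proof (rule eventually_conj)
    show "eventually (\<lambda>t. y < \<eta> t) at_top"
      using assms order_tendstoD(1)[of \<eta> 1 at_top y] by (simp add: sigmoid_def)
  qed (rule eventually_ge_at_top)
  then obtain b where b: "y < \<eta> b" "0 \<le> b"
    using eventually_happens'[OF trivial_limit_at_top_linorder] by blast
  have "continuous_on {0..b} \<eta>"
    using assms(1) by (auto simp: sigmoid_def intro: continuous_on_subset)
  then have "\<exists>x\<ge>0. x \<le> b \<and> \<eta> x = y"
    using b assms by (intro IVT') (auto simp: sigmoid_def)
  then show ?thesis
    by auto
qed

section \<open>Iterates of the capacity step\<close>

lemma capacity_iterate_above:
  assumes "P \<le> R"
  shows "(capacity_step \<eta> P ^^ k) R = R"
  using assms by (induction k) (simp_all add: capacity_step_def)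

text \<open>\<open>inv_into\<close> assigns to \<open>R\<close> its time on the adoption curve, and
  each step advances that time by one.\<close>

lemma capacity_iterate_below:
  assumes "sigmoid \<eta>" and "0 \<le> R" and "R < P"
  shows "(capacity_step \<eta> P ^^ k) R = P * \<eta> (real k + inv_into {0..} \<eta> (R / P))"
    and "0 \<le> inv_into {0..} \<eta> (R / P)"
proof -
  let ?t = "inv_into {0..} \<eta> (R / P)"
  have img: "R / P \<in> \<eta> ` {0..}"
    using assms by (intro sigmoid_image) auto
  show t: "0 \<le> ?t"
    using inv_into_into[OF img] by simp
  have inj: "inj_on \<eta> {0..}"
    using assms(1) by (auto simp: sigmoid_def intro: strict_mono_on_imp_inj_on)
  show "(capacity_step \<eta> P ^^ k) R = P * \<eta> (real k + ?t)"
  proof (induction k)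
    case 0
    then show ?case
      using f_inv_into_f[OF img] assms by simp
  next
    case (Suc k)
    \<comment> \<open>The iterate thus stays below \<open>P\<close>, so the second branch applies
      again, and injectivity of \<eta> recovers the time reached.\<close>
    have "\<eta> (real k + ?t) < 1"
      using t by (intro sigmoid_less_1[OF assms(1)]) simp
    then have "P * \<eta> (real k + ?t) < P"
      using assms by (simp add: mult_less_cancel_left2)
    moreover have "inv_into {0..} \<eta> (\<eta> (real k + ?t)) = real k + ?t"
      using t by (intro inv_into_f_f[OF inj]) simp
    ultimately show ?case
      using Suc assms by (simp add: capacity_step_def add_ac)
  qed
qed

text \<open>The time on the curve grows and \<eta> is strictly increasing but below 1. The strict
  increase later rules out equilibria with capacity below \<open>P\<close>.\<close>

lemma capacity_iterate_below_bounds: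
  assumes "sigmoid \<eta>" and "0 \<le> R" and "R < P"
  shows "R \<le> (capacity_step \<eta> P ^^ k) R" and "(capacity_step \<eta> P ^^ k) R < P"
    and "0 < k \<Longrightarrow> R < (capacity_step \<eta> P ^^ k) R"
proof -
  note it = capacity_iterate_below[OF assms]
  let ?t = "inv_into {0..} \<eta> (R / P)"
  have R: "R = P * \<eta> ?t"
    using it(1)[of 0] by simp
  have P: "0 < P"
    using assms by simp
  have less: "0 < k \<Longrightarrow> \<eta> ?t < \<eta> (real k + ?t)"
    using assms(1) it(2) by (auto simp: sigmoid_def strict_mono_on_def)
  then show lt: "0 < k \<Longrightarrow> R < (capacity_step \<eta> P ^^ k) R"
    using P R it(1)[of k] by (metis mult_less_cancel_left_pos)
  show "R \<le> (capacity_step \<eta> P ^^ k) R"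
    using lt by (cases "k = 0") auto
  have "\<eta> (real k + ?t) < 1"
    using it(2) by (intro sigmoid_less_1[OF assms(1)]) simp
  then show "(capacity_step \<eta> P ^^ k) R < P"
    using P it(1)[of k] by (simp add: mult_less_cancel_left2)
qed

text \<open>Iterates either rest at \<open>R\<close> or lie between \<open>R\<close> and
  \<open>P\<close>. That the distance to \<open>P\<close> never grows is the source of Lyapunov
  stability.\<close>

lemma capacity_iterate_bounds:
  assumes "sigmoid \<eta>" and "0 \<le> R"
  shows "0 \<le> (capacity_step \<eta> P ^^ k) R" and "\<bar>(capacity_step \<eta> P ^^ k) R - P\<bar> \<le> \<bar>R - P\<bar>"
  using assms capacity_iterate_above[of P R k \<eta>] capacity_iterate_below_bounds(1,2)[of \<eta> R P k]
  by (cases "P \<le> R"; simp add: not_le)+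

lemma capacity_iterate_tendsto:
  assumes "sigmoid \<eta>" and "0 \<le> R" and "R \<le> P"
  shows "(\<lambda>k. (capacity_step \<eta> P ^^ k) R) \<longlonglongrightarrow> P"
proof (cases "R = P")
  case True
  then show ?thesis
    by (simp add: capacity_iterate_above)
next
  case False
  then have "R < P"
    using assms by simp
  have "(\<eta> \<longlongrightarrow> 1) at_top"
    using assms by (simp add: sigmoid_def)
  moreover have "filterlim (\<lambda>k. real k + c) at_top sequentially" for c
    using filterlim_tendsto_add_at_top[OF tendsto_const filterlim_real_sequentially]
    by (simp add: add.commute)
  ultimately have "(\<lambda>k. \<eta> (real k + inv_into {0..} \<eta> (R / P))) \<longlonglongrightarrow> 1"
    by (rule filterlim_compose)
  from tendsto_mult_left[OF this, of P] show ?thesis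
    using capacity_iterate_below(1)[OF assms(1,2) \<open>R < P\<close>] by simp
qed

section \<open>Trajectories of the full state\<close>

lemma evolve_constant_potential:
  assumes "Rinf (\<mu> R) = P"
  shows "evolve \<eta> Rinf \<mu> (T, R) = (\<mu> R, capacity_step \<eta> P R)"
  using assms by (simp add: evolve_def Let_def capacity_step_def adoption_curve_def)

text \<open>The new tariff is set from the old capacity, so it lags one iterate behind; the formula
  starts at \<open>Suc k\<close> because the initial tariff \<open>T\<close> is arbitrary.\<close>

lemma trajectory_constant_potential:
  assumes "sigmoid \<eta>" and "\<And>R. 0 \<le> R \<Longrightarrow> Rinf (\<mu> R) = P" and "0 \<le> R"
  shows "trajectory \<eta> Rinf \<mu> (T, R) (Suc k) =
           (\<mu> ((capacity_step \<eta> P ^^ k) R), (capacity_step \<eta> P ^^ Suc k) R)"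
proof (induction k)
  case 0
  then show ?case
    using assms by (simp add: trajectory_def evolve_constant_potential)
next
  case (Suc k)
  \<comment> \<open>The potential is known to be \<open>P\<close> only at nonnegative capacities,
    hence the lower bound on the iterates.\<close>
  have "Rinf (\<mu> ((capacity_step \<eta> P ^^ Suc k) R)) = P"
    using assms capacity_iterate_bounds(1) by blast
  from evolve_constant_potential[where Rinf = Rinf and \<mu> = \<mu>, OF this] Suc show ?case
    by (simp add: trajectory_def)
qed

theorem theorem3:
  fixes m :: "('x, 'w, 'm::finite, 'n::finite) market"
    and \<theta> :: real
    and \<eta> :: "real \<Rightarrow> real"
    and Rinf :: "'n tariff \<Rightarrow> real"
    and \<mu> :: "real \<Rightarrow> 'n tariff"
    and p :: "real \<Rightarrow> real"
    and \<sigma>\<^sub>s :: "'n state"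
  assumes "well_posed m"
    and "sigmoid \<eta>"
    and "price_driven_potential Rinf"
    and "ramsey_policy m \<theta> \<mu>"
    and "p = potential_of_policy Rinf \<mu>"
    and "\<sigma>\<^sub>s = (\<mu> (p 0), p 0)"
  shows "(\<forall>T\<^sub>0 R\<^sub>0. 0 \<le> R\<^sub>0 \<and> R\<^sub>0 \<le> p 0 \<longrightarrow>
            \<not> death_spiral m \<theta> (trajectory \<eta> Rinf \<mu> (T\<^sub>0, R\<^sub>0)) \<and>
            trajectory \<eta> Rinf \<mu> (T\<^sub>0, R\<^sub>0) \<longlonglongrightarrow> \<sigma>\<^sub>s)
       \<and> stable_equilibrium m \<theta> \<eta> Rinf \<mu> \<sigma>\<^sub>s
       \<and> (\<forall>\<sigma>. stable_equilibrium m \<theta> \<eta> Rinf \<mu> \<sigma> \<and> 0 \<le> snd \<sigma> \<and> snd \<sigma> \<le> p 0 \<longrightarrow> \<sigma> = \<sigma>\<^sub>s)"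
proof -
  let ?P = "p 0"
  let ?cap = "\<lambda>R k. (capacity_step \<eta> ?P ^^ k) R"
  note sig = \<open>sigmoid \<eta>\<close>
  have P: "Rinf (\<mu> R) = ?P" if "0 \<le> R" for R
  proof -
    \<comment> \<open>The potential ignores the charge, and the price at \<open>R\<close> is the
      price at \<open>0\<close>.\<close>
    have "Rinf (fst (\<mu> R), snd (\<mu> R)) = Rinf (fst (\<mu> 0), snd (\<mu> R))"
      using assms(3) unfolding price_driven_potential_def by blast
    then show ?thesis
      using ramsey_policy_price[OF assms(1,4) that order_refl] assms(5)
      by (metis potential_of_policy_def prod.collapse)
  qed
  have P0: "0 \<le> ?P"
    using assms(3,5) unfolding price_driven_potential_def potential_of_policy_def by blast
  note traj = trajectory_constant_potential[of \<eta> Rinf \<mu> ?P, OF sig P]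
  obtain c where c: "0 \<le> c"
    and lip: "\<And>R R'. 0 \<le> R \<Longrightarrow> 0 \<le> R' \<Longrightarrow> norm (\<mu> R - \<mu> R') \<le> c * \<bar>R - R'\<bar>"
    using ramsey_policy_lipschitz[OF assms(1,4)] by blast
  \<comment> \<open>Everything reduces to capacities: the Lipschitz bound handles the lagging
    tariff. Convergence and stability both follow from this estimate.\<close>
  have dist: "norm (trajectory \<eta> Rinf \<mu> (T, R) (Suc k) - \<sigma>\<^sub>s)
      \<le> c * \<bar>?cap R k - ?P\<bar> + \<bar>?cap R (Suc k) - ?P\<bar>" if "0 \<le> R" for T R k
  proof -
    have "norm (trajectory \<eta> Rinf \<mu> (T, R) (Suc k) - \<sigma>\<^sub>s)
        \<le> norm (\<mu> (?cap R k) - \<mu> ?P) + norm (?cap R (Suc k) - ?P)"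
      using norm_Pair_le[of "\<mu> (?cap R k) - \<mu> ?P" "?cap R (Suc k) - ?P"]
      by (simp add: traj[OF _ that] assms(6))
    then show ?thesis
      using lip[OF capacity_iterate_bounds(1)[OF sig that, of k ?P] P0] by simp
  qed
  have conv: "trajectory \<eta> Rinf \<mu> (T, R) \<longlonglongrightarrow> \<sigma>\<^sub>s" if R: "0 \<le> R" "R \<le> ?P" for T R
  proof -
    have lim: "(\<lambda>k. ?cap R k - ?P) \<longlonglongrightarrow> 0"
      by (rule LIM_zero[OF capacity_iterate_tendsto[OF sig R]])
    have "(\<lambda>k. c * \<bar>?cap R k - ?P\<bar> + \<bar>?cap R (Suc k) - ?P\<bar>) \<longlonglongrightarrow> c * \<bar>0\<bar> + \<bar>0\<bar>"
      by (intro tendsto_intros lim LIMSEQ_Suc[OF lim])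
    then have lim0: "(\<lambda>k. c * \<bar>?cap R k - ?P\<bar> + \<bar>?cap R (Suc k) - ?P\<bar>) \<longlonglongrightarrow> 0"
      by (simp only: abs_zero mult_zero_right add_0_right)
    have "(\<lambda>k. trajectory \<eta> Rinf \<mu> (T, R) (Suc k) - \<sigma>\<^sub>s) \<longlonglongrightarrow> 0"
      by (rule Lim_null_comparison[OF always_eventually lim0]) (intro allI dist[OF R(1)])
    from LIMSEQ_imp_Suc[OF LIM_zero_cancel[OF this]] show ?thesis .
  qed
  have ev: "evolve \<eta> Rinf \<mu> \<sigma> = (\<mu> (snd \<sigma>), capacity_step \<eta> ?P (snd \<sigma>))" if "0 \<le> snd \<sigma>" for \<sigma>
    using evolve_constant_potential[of Rinf \<mu> "snd \<sigma>" ?P \<eta> "fst \<sigma>"] P[OF that] by simp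
  have stab: "lyapunov_stable m \<theta> \<eta> Rinf \<mu> \<sigma>\<^sub>s"
    unfolding lyapunov_stable_def
  proof (intro allI impI)
    fix \<epsilon> :: real
    assume \<epsilon>: "0 < \<epsilon>"
    \<comment> \<open>By \<open>dist\<close> and the nonincreasing capacity gap, every later
      distance is at most \<open>c + 1\<close> times the initial gap, hence the radius
      \<open>\<epsilon> / (c + 1)\<close>.\<close>
    have "norm (trajectory \<eta> Rinf \<mu> \<sigma>\<^sub>0 k - \<sigma>\<^sub>s) < \<epsilon>"
      if \<sigma>0: "0 \<le> snd \<sigma>\<^sub>0" "norm (\<sigma>\<^sub>0 - \<sigma>\<^sub>s) < \<epsilon> / (c + 1)" and k: "0 < k" for \<sigma>\<^sub>0 k
    proof -
      obtain j where j: "k = Suc j"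
        using k gr0_implies_Suc by blast
      let ?R = "snd \<sigma>\<^sub>0"
      have "\<bar>?R - ?P\<bar> \<le> norm (\<sigma>\<^sub>0 - \<sigma>\<^sub>s)"
        using dist_snd_le[of \<sigma>\<^sub>0 \<sigma>\<^sub>s] assms(6) by (simp add: dist_norm)
      then have "\<bar>?R - ?P\<bar> < \<epsilon> / (c + 1)"
        using \<sigma>0(2) by (rule le_less_trans)
      then have near: "(c + 1) * \<bar>?R - ?P\<bar> < \<epsilon>"
        using c by (simp add: pos_less_divide_eq mult.commute)
      have "norm (trajectory \<eta> Rinf \<mu> \<sigma>\<^sub>0 k - \<sigma>\<^sub>s)
          \<le> c * \<bar>?cap ?R j - ?P\<bar> + \<bar>?cap ?R (Suc j) - ?P\<bar>"
        using dist[OF \<sigma>0(1), of "fst \<sigma>\<^sub>0" j] by (simp only: j prod.collapse)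
      also have "\<dots> \<le> c * \<bar>?R - ?P\<bar> + \<bar>?R - ?P\<bar>"
        by (intro add_mono mult_left_mono capacity_iterate_bounds(2)[OF sig \<sigma>0(1)] c)
      also have "\<dots> < \<epsilon>"
        using near by (simp add: algebra_simps)
      finally show ?thesis .
    qed
    note close = this
    show "\<exists>\<delta>>0. \<forall>\<sigma>\<^sub>0. 0 \<le> snd \<sigma>\<^sub>0 \<and> \<not> death_spiral m \<theta> (trajectory \<eta> Rinf \<mu> \<sigma>\<^sub>0) \<and>
        norm (\<sigma>\<^sub>0 - \<sigma>\<^sub>s) < \<delta> \<longrightarrow> (\<forall>k>0. norm (trajectory \<eta> Rinf \<mu> \<sigma>\<^sub>0 k - \<sigma>\<^sub>s) < \<epsilon>)"
    proof (intro exI[of _ "\<epsilon> / (c + 1)"] conjI allI impI; (elim conjE)?)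
      show "0 < \<epsilon> / (c + 1)"
        using \<epsilon> c by simp
    qed (rule close)
  qed
  have eq: "equilibrium \<eta> Rinf \<mu> \<sigma>\<^sub>s"
    using ev[of \<sigma>\<^sub>s] P0 assms(6) by (simp add: equilibrium_def capacity_step_def)
  \<comment> \<open>The upper bound matters: \<open>(\<mu> R, R)\<close> is an equilibrium for every
    \<open>R\<close> above \<open>p 0\<close> as well. Below \<open>p 0\<close> one step strictly
    raises the capacity.\<close>
  have uniq: "\<sigma> = \<sigma>\<^sub>s" if "equilibrium \<eta> Rinf \<mu> \<sigma>" "0 \<le> snd \<sigma>" "snd \<sigma> \<le> ?P" for \<sigma>
  proof -
    have "evolve \<eta> Rinf \<mu> \<sigma> = \<sigma>"
      using that(1) unfolding equilibrium_def by (elim conjE) (rule sym)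
    then have fixed: "(\<mu> (snd \<sigma>), capacity_step \<eta> ?P (snd \<sigma>)) = \<sigma>"
      unfolding ev[OF that(2)] .
    then have step: "capacity_step \<eta> ?P (snd \<sigma>) = snd \<sigma>"
      by (metis snd_conv)
    have "snd \<sigma> = ?P"
    proof (rule ccontr)
      assume "snd \<sigma> \<noteq> ?P"
      with that(3) have "snd \<sigma> < ?P"
        by simp
      from capacity_iterate_below_bounds(3)[OF sig that(2) this, of 1] step show False
        by simp
    qed
    then show ?thesis
      using fixed step assms(6) by simp
  qed
  show ?thesis
    unfolding stable_equilibrium_def
    by (intro conjI allI impI; (elim conjE)?)
      (assumption | rule conv stab eq uniq not_death_spiral[OF assms(1)])+
qed

end
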